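(* Let the errors $\epsilon_i$ be i.i.d. $\mathcal{N}(0,\sigma^2)$, and let $\Omega\in\mathscr{P}_k$ be a polytopal domain in $\mathbb{R}^d$ and $\Gamma>0$. Then $$R_\nu(n;\mathcal{C}(\Gamma))\ge \mathfrak{C}\, n^{-4/(d+4)},$$ where $\mathfrak{C}>0$ is a constant depending only on $d,\Omega,\Gamma,\sigma,\nu$.
   Context: Random design regression model: $\Omega\subset\mathbb{R}^d$ is a convex body, $X_1,\dots,X_n$ are i.i.d. from a probability measure $\nu$ on $\Omega$, absolutely continuous with respect to Lebesgue measure $\lambda$ with $\nu_{\max}:=\sup_{x\in\Omega}\frac{d\nu}{d\lambda}(x)<\infty$ and $\nu_{\min}:=\inf_{x\in\Omega}\frac{d\nu}{d\lambda}(x)>0$; $Y_i=f(X_i)+\epsilon_i$ with errors independent of the $X_i$'s. The loss is $l_\nu^2(f,g):=\int_\Omega (f-g)^2\,d\nu$, and $R_\nu(n;\mathcal{F}):=\inf_{\hat f_n}\sup_{f\in\mathcal{F}}\mathbb{E}_f\,l_\nu^2(f,\hat f_n)$, the infimum being over all estimators based on $(X_i,Y_i)_{i=1}^n$. $\mathcal{C}(\Gamma)$ is the class of convex functions $f$ on $\Omega$ with $\sup_\Omega|f|\le\Gamma$. $\mathscr{P}_k$ is the collection of polytopes that can be written as a union of at most $k$ simplices with pairwise disjoint interiors. *)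

theory Defs
  imports "HOL-Probability.Probability"
begin

definition convex_body :: "'a::euclidean_space set \<Rightarrow> bool" where
  "convex_body \<Omega> \<longleftrightarrow> compact \<Omega> \<and> convex \<Omega> \<and> interior \<Omega> \<noteq> {}"

text \<open>Simplices are full-dimensional, so that disjointness of interiors is a genuine condition.\<close>

definition simplicial_polytopes :: "nat \<Rightarrow> 'a::euclidean_space set set" where
  "simplicial_polytopes k =
     {P. polytope P \<and>
         (\<exists>\<S>. finite \<S> \<and> card \<S> \<le> k \<and> (\<forall>S\<in>\<S>. int DIM('a) simplex S) \<and>
              pairwise (\<lambda>S T. interior S \<inter> interior T = {}) \<S> \<and> P = \<Union>\<S>)}"

text \<open>Functions are total on the ambient space; only their values on \<open>\<Omega>\<close> ever matter.\<close>

definition bounded_convex_class :: "'a::euclidean_space set \<Rightarrow> real \<Rightarrow> ('a \<Rightarrow> real) set" where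
  "bounded_convex_class \<Omega> \<Gamma> = {f. convex_on \<Omega> f \<and> (\<forall>x\<in>\<Omega>. \<bar>f x\<bar> \<le> \<Gamma>)}"

definition gaussian :: "real \<Rightarrow> real measure" where
  "gaussian \<sigma> = density lborel (\<lambda>x. ennreal (normal_density 0 \<sigma> x))"

definition sq_loss :: "'a measure \<Rightarrow> ('a \<Rightarrow> real) \<Rightarrow> ('a \<Rightarrow> real) \<Rightarrow> ennreal" where
  "sq_loss \<nu> f g = (\<integral>\<^sup>+x. ennreal ((f x - g x)\<^sup>2) \<partial>\<nu>)"

text \<open>
  An estimator maps the data \<open>(X\<^sub>i, Y\<^sub>i)\<close>, \<open>i < n\<close>, to a function on the design space. Joint
  measurability in the data and the evaluation point makes its loss a random variable.
  Design measures \<open>\<nu>\<close> live on the domain itself, that is, \<open>space \<nu> = \<Omega>\<close>.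
\<close>

definition estimators :: "'a measure \<Rightarrow> nat \<Rightarrow> ((nat \<Rightarrow> 'a \<times> real) \<Rightarrow> 'a \<Rightarrow> real) set" where
  "estimators \<nu> n =
     {g. (\<lambda>(z, x). g z x) \<in> borel_measurable ((\<Pi>\<^sub>M i\<in>{..<n}. \<nu> \<Otimes>\<^sub>M borel) \<Otimes>\<^sub>M \<nu>)}"

definition regression_data ::
    "nat \<Rightarrow> ('a \<Rightarrow> real) \<Rightarrow> (nat \<Rightarrow> 'a) \<Rightarrow> (nat \<Rightarrow> real) \<Rightarrow> (nat \<Rightarrow> 'a \<times> real)" where
  "regression_data n f X \<epsilon> = (\<lambda>i\<in>{..<n}. (X i, f (X i) + \<epsilon> i))"

text \<open>
  The canonical sample space: \<open>X\<^sub>i\<close> i.i.d. with law \<open>\<nu>\<close>, errors i.i.d. with law \<open>\<mu>\<close>, and the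
  errors independent of the design.
\<close>

definition regression_space ::
    "'a measure \<Rightarrow> real measure \<Rightarrow> nat \<Rightarrow> ((nat \<Rightarrow> 'a) \<times> (nat \<Rightarrow> real)) measure" where
  "regression_space \<nu> \<mu> n = (\<Pi>\<^sub>M i\<in>{..<n}. \<nu>) \<Otimes>\<^sub>M (\<Pi>\<^sub>M i\<in>{..<n}. \<mu>)"

definition risk ::
    "'a measure \<Rightarrow> real measure \<Rightarrow> nat \<Rightarrow> ('a \<Rightarrow> real) \<Rightarrow>
     ((nat \<Rightarrow> 'a \<times> real) \<Rightarrow> 'a \<Rightarrow> real) \<Rightarrow> ennreal" where
  "risk \<nu> \<mu> n f g =
     (\<integral>\<^sup>+(X, \<epsilon>). sq_loss \<nu> f (g (regression_data n f X \<epsilon>)) \<partial>regression_space \<nu> \<mu> n)"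

definition minimax_risk ::
    "'a measure \<Rightarrow> real measure \<Rightarrow> nat \<Rightarrow> ('a \<Rightarrow> real) set \<Rightarrow> ennreal" where
  "minimax_risk \<nu> \<mu> n F = (INF g\<in>estimators \<nu> n. SUP f\<in>F. risk \<nu> \<mu> n f g)"

end

theory Submission
  imports Defs
begin

text \<open>
  The bound follows from Assouad's method on a hypercube of perturbed paraboloids. Inside a ball
  contained in \<open>\<Omega>\<close>, place a grid of \<open>m = M ^ d\<close> disjoint balls of radius \<open>r\<close> of order \<open>1 / M\<close>.
  Raising the paraboloid \<open>a * (norm (x - c))\<^sup>2\<close> to its lifted tangent plane on any subset of these
  balls keeps it convex, and toggling one ball changes it by an amount of order \<open>r ^ (d + 4)\<close> in
  squared \<open>L\<^sup>2(\<nu>)\<close> norm. For \<open>M\<close> of order \<open>n powr (1 / (d + 4))\<close> and small \<open>a\<close>, one toggle cannot be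
  detected reliably from \<open>n\<close> observations, so each of the \<open>m\<close> balls costs a loss of order
  \<open>r ^ (d + 4)\<close>, and \<open>m * r ^ (d + 4)\<close> is of order \<open>1 / M ^ 4\<close>.
\<close>

section \<open>Translated Gaussian noise\<close>

lemma vimage_plus_borel:
  fixes t :: real
  assumes "A \<in> sets borel"
  shows "(\<lambda>x. t + x) -` A \<in> sets borel"
  using measurable_sets[of "\<lambda>x. t + x" borel borel A] assms by simp

lemma emeasure_gaussian_translate:
  assumes [measurable]: "A \<in> sets borel"
  shows "emeasure (gaussian \<sigma>) ((\<lambda>x. t + x) -` A) =
    emeasure (density lborel (\<lambda>x. ennreal (normal_density t \<sigma> x))) A"
proof -
  have "emeasure (density lborel (\<lambda>x. ennreal (normal_density t \<sigma> x))) A =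
      (\<integral>\<^sup>+x. ennreal (normal_density t \<sigma> x) * indicator A x \<partial>lborel)"
    by (subst emeasure_density) auto
  also have "\<dots> = (\<integral>\<^sup>+x. ennreal (normal_density t \<sigma> (t + 1 * x)) * indicator A (t + 1 * x) \<partial>lborel)"
    by (subst nn_integral_real_affine[where c = 1 and t = t]) auto
  also have "\<dots> = (\<integral>\<^sup>+x. ennreal (normal_density 0 \<sigma> x) * indicator ((\<lambda>x. t + x) -` A) x \<partial>lborel)"
    by (auto intro!: nn_integral_cong simp: normal_density_def indicator_def)
  also have "\<dots> = emeasure (gaussian \<sigma>) ((\<lambda>x. t + x) -` A)"
    unfolding gaussian_def by (subst emeasure_density) (auto simp: vimage_plus_borel)
  finally show ?thesis by simp
qed

lemma product_sigma_finite_normal: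
  assumes "\<sigma> > 0"
  shows "product_sigma_finite (\<lambda>i. density lborel (\<lambda>x. ennreal (normal_density (t i) \<sigma> x)))"
  using prob_space_normal_density[OF assms]
  by (auto simp: product_sigma_finite_def intro: prob_space_imp_sigma_finite)

text \<open>Both sides are determined by their values on rectangles. The preimage of a rectangle
  under a coordinatewise shift is again a rectangle, so the one-dimensional translation applies
  factor by factor.\<close>

lemma PiM_gaussian_translate:
  assumes I: "finite I" and \<sigma>: "\<sigma> > 0"
  shows "distr (\<Pi>\<^sub>M i\<in>I. gaussian \<sigma>) (\<Pi>\<^sub>M i\<in>I. borel) (\<lambda>\<epsilon>. \<lambda>i\<in>I. t i + \<epsilon> i) =
    (\<Pi>\<^sub>M i\<in>I. density lborel (\<lambda>x. ennreal (normal_density (t i) \<sigma> x)))" (is "?L = Pi\<^sub>M I ?N")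
proof -
  interpret N: product_sigma_finite ?N by (rule product_sigma_finite_normal[OF \<sigma>])
  interpret G: product_sigma_finite "\<lambda>_. gaussian \<sigma>"
    using product_sigma_finite_normal[OF \<sigma>, of "\<lambda>_. 0"] by (simp add: gaussian_def)
  have sets_G: "sets (Pi\<^sub>M I (\<lambda>_. gaussian \<sigma>)) = sets (Pi\<^sub>M I (\<lambda>_. borel))"
    by (intro sets_PiM_cong) (auto simp: gaussian_def)
  have sp: "space (gaussian \<sigma>) = UNIV" by (simp add: gaussian_def)
  have [measurable]: "(\<lambda>\<epsilon>. \<lambda>i\<in>I. t i + \<epsilon> i) \<in> Pi\<^sub>M I (\<lambda>_. gaussian \<sigma>) \<rightarrow>\<^sub>M Pi\<^sub>M I (\<lambda>_. borel)"
    unfolding measurable_cong_sets[OF sets_G refl] by measurable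
  show ?thesis
  proof (rule N.PiM_eqI[OF I])
    show "sets ?L = sets (Pi\<^sub>M I ?N)"
      by (simp, intro sets_PiM_cong) auto
  next
    fix A assume A: "\<And>i. i \<in> I \<Longrightarrow> A i \<in> sets (?N i)"
    have "emeasure ?L (Pi\<^sub>E I A) =
        emeasure (Pi\<^sub>M I (\<lambda>_. gaussian \<sigma>))
          ((\<lambda>\<epsilon>. \<lambda>i\<in>I. t i + \<epsilon> i) -` Pi\<^sub>E I A \<inter> space (Pi\<^sub>M I (\<lambda>_. gaussian \<sigma>)))"
      using A I by (subst emeasure_distr) (auto intro!: sets_PiM_I_finite)
    also have "(\<lambda>\<epsilon>. \<lambda>i\<in>I. t i + \<epsilon> i) -` Pi\<^sub>E I A \<inter> space (Pi\<^sub>M I (\<lambda>_. gaussian \<sigma>)) =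
        (\<Pi>\<^sub>E i\<in>I. (\<lambda>x. t i + x) -` A i)"
      by (auto simp: space_PiM sp PiE_iff extensional_def)
    also have "emeasure (Pi\<^sub>M I (\<lambda>_. gaussian \<sigma>)) \<dots> =
        (\<Prod>i\<in>I. emeasure (gaussian \<sigma>) ((\<lambda>x. t i + x) -` A i))"
      using A I by (intro G.emeasure_PiM) (auto simp: gaussian_def vimage_plus_borel)
    also have "\<dots> = (\<Prod>i\<in>I. emeasure (?N i) (A i))"
      using A by (intro prod.cong refl emeasure_gaussian_translate) auto
    finally show "emeasure ?L (Pi\<^sub>E I A) = (\<Prod>i\<in>I. emeasure (?N i) (A i))" .
  qed
qed

text \<open>Tested on rectangles: the indicator of a finite rectangle factorizes, and Tonelli turns
  the integral of the product into the product of the integrals.\<close>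

lemma PiM_normal_density:
  assumes I: "finite I" and \<sigma>: "\<sigma> > 0"
  shows "(\<Pi>\<^sub>M i\<in>I. density lborel (\<lambda>x. ennreal (normal_density (t i) \<sigma> x))) =
    density (\<Pi>\<^sub>M i\<in>I. lborel) (\<lambda>y. \<Prod>i\<in>I. ennreal (normal_density (t i) \<sigma> (y i)))"
    (is "Pi\<^sub>M I ?N = ?R")
proof -
  interpret N: product_sigma_finite ?N by (rule product_sigma_finite_normal[OF \<sigma>])
  interpret L: product_sigma_finite "\<lambda>_. lborel :: real measure"
    by (simp add: product_sigma_finite_def lborel.sigma_finite_measure_axioms)
  have "?R = Pi\<^sub>M I ?N"
  proof (rule N.PiM_eqI[OF I])
    show "sets ?R = sets (Pi\<^sub>M I ?N)"
      by (simp, intro sets_PiM_cong) auto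
  next
    fix A assume A: "\<And>i. i \<in> I \<Longrightarrow> A i \<in> sets (?N i)"
    then have [measurable]: "Pi\<^sub>E I A \<in> sets (Pi\<^sub>M I (\<lambda>_. lborel))"
      using I by (intro sets_PiM_I_finite) auto
    have "emeasure ?R (Pi\<^sub>E I A) =
      (\<integral>\<^sup>+y. (\<Prod>i\<in>I. ennreal (normal_density (t i) \<sigma> (y i))) * indicator (Pi\<^sub>E I A) y \<partial>Pi\<^sub>M I (\<lambda>_. lborel))"
      by (subst emeasure_density) auto
    also have "\<dots> = (\<integral>\<^sup>+y. (\<Prod>i\<in>I. ennreal (normal_density (t i) \<sigma> (y i)) * indicator (A i) (y i)) \<partial>Pi\<^sub>M I (\<lambda>_. lborel))"
    proof (rule nn_integral_cong)
      fix y :: "_ \<Rightarrow> real" assume "y \<in> space (Pi\<^sub>M I (\<lambda>_. lborel))"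
      then have "indicator (Pi\<^sub>E I A) y = (\<Prod>i\<in>I. indicator (A i) (y i) :: ennreal)"
        using I by (auto simp: space_PiM PiE_iff indicator_def prod_zero_iff)
      then show "(\<Prod>i\<in>I. ennreal (normal_density (t i) \<sigma> (y i))) * indicator (Pi\<^sub>E I A) y =
        (\<Prod>i\<in>I. ennreal (normal_density (t i) \<sigma> (y i)) * indicator (A i) (y i))"
        by (simp add: prod.distrib)
    qed
    also have "\<dots> = (\<Prod>i\<in>I. \<integral>\<^sup>+x. ennreal (normal_density (t i) \<sigma> x) * indicator (A i) x \<partial>lborel)"
      using A I by (intro L.product_nn_integral_prod) auto
    also have "\<dots> = (\<Prod>i\<in>I. emeasure (?N i) (A i))"
      using A by (intro prod.cong refl) (subst emeasure_density, auto)
    finally show "emeasure ?R (Pi\<^sub>E I A) = (\<Prod>i\<in>I. emeasure (?N i) (A i))" .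
  qed
  then show ?thesis by simp
qed

text \<open>Puts expectations under different regression functions on one reference measure,
  Lebesgue measure on the responses, where their densities can be compared pointwise.\<close>

lemma nn_integral_gaussian_translate:
  assumes I: "finite I" and \<sigma>: "\<sigma> > 0" and H: "H \<in> borel_measurable (\<Pi>\<^sub>M i\<in>I. borel)"
  shows "(\<integral>\<^sup>+\<epsilon>. H (\<lambda>i\<in>I. t i + \<epsilon> i) \<partial>(\<Pi>\<^sub>M i\<in>I. gaussian \<sigma>)) =
    (\<integral>\<^sup>+y. ennreal (\<Prod>i\<in>I. normal_density (t i) \<sigma> (y i)) * H y \<partial>(\<Pi>\<^sub>M i\<in>I. lborel))"
proof -
  have sets_G: "sets (Pi\<^sub>M I (\<lambda>_. gaussian \<sigma>)) = sets (Pi\<^sub>M I (\<lambda>_. borel))"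
    by (intro sets_PiM_cong) (auto simp: gaussian_def)
  have sets_L: "sets (Pi\<^sub>M I (\<lambda>_. lborel)) = sets (Pi\<^sub>M I (\<lambda>_. borel))"
    by (intro sets_PiM_cong) auto
  have H': "H \<in> borel_measurable (\<Pi>\<^sub>M i\<in>I. lborel)"
    using H by (simp add: measurable_cong_sets[OF sets_L refl])
  have "(\<lambda>\<epsilon>. \<lambda>i\<in>I. t i + \<epsilon> i) \<in> Pi\<^sub>M I (\<lambda>_. gaussian \<sigma>) \<rightarrow>\<^sub>M Pi\<^sub>M I (\<lambda>_. borel)"
    unfolding measurable_cong_sets[OF sets_G refl] by measurable
  then have "(\<integral>\<^sup>+\<epsilon>. H (\<lambda>i\<in>I. t i + \<epsilon> i) \<partial>(\<Pi>\<^sub>M i\<in>I. gaussian \<sigma>)) =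
      (\<integral>\<^sup>+y. H y \<partial>distr (\<Pi>\<^sub>M i\<in>I. gaussian \<sigma>) (\<Pi>\<^sub>M i\<in>I. borel) (\<lambda>\<epsilon>. \<lambda>i\<in>I. t i + \<epsilon> i))"
    using H by (subst nn_integral_distr) simp_all
  also have "\<dots> = (\<integral>\<^sup>+y. ennreal (\<Prod>i\<in>I. normal_density (t i) \<sigma> (y i)) * H y \<partial>(\<Pi>\<^sub>M i\<in>I. lborel))"
    unfolding PiM_gaussian_translate[OF I \<sigma>] PiM_normal_density[OF I \<sigma>]
    by (subst nn_integral_density) (auto simp: H' prod_ennreal)
  finally show ?thesis .
qed

section \<open>Two-point inequality for Gaussian product laws\<close>

text \<open>For two probability densities, integration turns this into a lower bound on the mass of their
  minimum by the Hellinger affinity, which factorizes over products.\<close>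

lemma sqrt_le_min_plus:
  fixes p q :: real
  assumes "p \<ge> 0" "q \<ge> 0"
  shows "sqrt (p * q) \<le> min p q + (p + q) / 4"
proof -
  have *: "u * v \<le> u\<^sup>2 + (u\<^sup>2 + v\<^sup>2) / 4" for u v :: real
  proof -
    have "u\<^sup>2 + (u\<^sup>2 + v\<^sup>2) / 4 - u * v = (u - v / 2)\<^sup>2 + u\<^sup>2 / 4"
      by (simp add: power2_eq_square field_simps)
    then show ?thesis
      using zero_le_power2[of "u - v / 2"] zero_le_power2[of u] by linarith
  qed
  \<comment> \<open>Both orders are needed so that \<open>u\<close> can be the root of the smaller
    of \<open>p\<close> and \<open>q\<close>.\<close>
  show ?thesis
    using *[of "sqrt p" "sqrt q"] *[of "sqrt q" "sqrt p"] assms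
    by (simp add: real_sqrt_mult mult.commute min_def add.commute)
qed

text \<open>Completing the square around the midpoint of \<open>s\<close> and \<open>t\<close>. The
  geometric mean of the two densities is thus the density at the midpoint, damped by the Hellinger
  affinity of the two laws.\<close>

lemma normal_density_mult:
  assumes "\<sigma> > 0"
  shows "normal_density s \<sigma> y * normal_density t \<sigma> y =
    (exp (- (s - t)\<^sup>2 / (8 * \<sigma>\<^sup>2)) * normal_density ((s + t) / 2) \<sigma> y)\<^sup>2"
proof -
  have "- (y - s)\<^sup>2 / (2 * \<sigma>\<^sup>2) + - (y - t)\<^sup>2 / (2 * \<sigma>\<^sup>2) =
      2 * (- (s - t)\<^sup>2 / (8 * \<sigma>\<^sup>2)) + 2 * (- (y - (s + t) / 2)\<^sup>2 / (2 * \<sigma>\<^sup>2))"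
    using assms by (simp add: field_simps power2_eq_square)
  then have "exp (- (y - s)\<^sup>2 / (2 * \<sigma>\<^sup>2)) * exp (- (y - t)\<^sup>2 / (2 * \<sigma>\<^sup>2)) =
      (exp (- (s - t)\<^sup>2 / (8 * \<sigma>\<^sup>2)) * exp (- (y - (s + t) / 2)\<^sup>2 / (2 * \<sigma>\<^sup>2)))\<^sup>2"
    by (simp add: power_mult_distrib flip: exp_add exp_double)
  then show ?thesis
    by (simp add: normal_density_def power2_eq_square algebra_simps)
qed

lemma nn_integral_prod_normal_density:
  assumes I: "finite I" and \<sigma>: "\<sigma> > 0"
  shows "(\<integral>\<^sup>+y. ennreal (\<Prod>i\<in>I. normal_density (t i) \<sigma> (y i)) \<partial>(\<Pi>\<^sub>M i\<in>I. lborel)) = 1"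
proof -
  interpret L: product_sigma_finite "\<lambda>_. lborel :: real measure"
    by (simp add: product_sigma_finite_def lborel.sigma_finite_measure_axioms)
  have "(\<integral>\<^sup>+y. ennreal (\<Prod>i\<in>I. normal_density (t i) \<sigma> (y i)) \<partial>(\<Pi>\<^sub>M i\<in>I. lborel)) =
      (\<Prod>i\<in>I. \<integral>\<^sup>+x. ennreal (normal_density (t i) \<sigma> x) \<partial>lborel)"
    by (subst L.product_nn_integral_prod[OF I, symmetric]) (auto simp: prod_ennreal)
  also have "\<dots> = 1"
    using prob_space.emeasure_space_1[OF prob_space_normal_density[OF \<sigma>]]
    by (simp add: emeasure_density)
  finally show ?thesis .
qed

text \<open>Le Cam's two-point bound: \<open>A\<close> and \<open>B\<close> are the losses of one
  procedure under two mean vectors, and no data make both small. The loss term stays on the right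
  because \<Delta> may be infinite and subtraction in \<open>ennreal\<close> truncates. The 1/2 is
  the integral of \<open>(p + q) / 4\<close>.\<close>

lemma gaussian_two_point:
  assumes I: "finite I" and \<sigma>: "\<sigma> > 0"
    and A: "A \<in> borel_measurable (\<Pi>\<^sub>M i\<in>I. borel)" and B: "B \<in> borel_measurable (\<Pi>\<^sub>M i\<in>I. borel)"
    and le: "\<And>y. \<Delta> \<le> A y + B y"
  shows "\<Delta> \<le> (\<integral>\<^sup>+\<epsilon>. A (\<lambda>i\<in>I. s i + \<epsilon> i) \<partial>(\<Pi>\<^sub>M i\<in>I. gaussian \<sigma>)) +
    (\<integral>\<^sup>+\<epsilon>. B (\<lambda>i\<in>I. t i + \<epsilon> i) \<partial>(\<Pi>\<^sub>M i\<in>I. gaussian \<sigma>)) +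
    \<Delta> * (1 / 2 + (\<Sum>i\<in>I. ennreal ((s i - t i)\<^sup>2 / (8 * \<sigma>\<^sup>2))))"
proof -
  let ?L = "\<Pi>\<^sub>M i\<in>I. (lborel :: real measure)"
  let ?p = "\<lambda>y. \<Prod>i\<in>I. normal_density (s i) \<sigma> (y i)"
  let ?q = "\<lambda>y. \<Prod>i\<in>I. normal_density (t i) \<sigma> (y i)"
  let ?r = "\<lambda>y. \<Prod>i\<in>I. normal_density ((s i + t i) / 2) \<sigma> (y i)"
  define W where "W = (\<Sum>i\<in>I. (s i - t i)\<^sup>2 / (8 * \<sigma>\<^sup>2))"
  have W0: "W \<ge> 0" unfolding W_def by (intro sum_nonneg) auto
  have sets_L: "sets ?L = sets (Pi\<^sub>M I (\<lambda>_. borel))"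
    by (intro sets_PiM_cong) auto
  have [measurable]: "A \<in> borel_measurable ?L" "B \<in> borel_measurable ?L"
    using A B by (simp_all add: measurable_cong_sets[OF sets_L refl])
  have p0: "?p y \<ge> 0" and q0: "?q y \<ge> 0" and r0: "?r y \<ge> 0" for y
    by (auto intro!: prod_nonneg)
  have root: "sqrt (?p y * ?q y) = exp (- W) * ?r y" for y
  proof -
    have "?p y * ?q y = (exp (- W) * ?r y)\<^sup>2"
      using I \<sigma> by (simp add: W_def exp_sum normal_density_mult
          flip: prod.distrib sum_negf prod_power_distrib)
    then show ?thesis by (simp add: real_sqrt_unique r0)
  qed
  \<comment> \<open>Since \<open>A + B\<close> is at least \<Delta>, the minimum of \<open>p\<close>
    and \<open>q\<close> times \<Delta> is at most \<open>p * A + q * B\<close>; the remaining term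
    comes from \<open>sqrt_le_min_plus\<close>.\<close>
  have pw: "\<Delta> * (ennreal (exp (- W)) * ennreal (?r y)) \<le>
      ennreal (?p y) * A y + ennreal (?q y) * B y + \<Delta> / 4 * (ennreal (?p y) + ennreal (?q y))" for y
  proof -
    let ?m = "min (?p y) (?q y)"
    have "ennreal (exp (- W)) * ennreal (?r y) = ennreal (sqrt (?p y * ?q y))"
      by (simp add: root ennreal_mult r0)
    also have "\<dots> \<le> ennreal (?m + (?p y + ?q y) / 4)"
      using sqrt_le_min_plus[OF p0 q0] by (rule ennreal_leI)
    also have "\<dots> = ennreal ?m + (ennreal (?p y) + ennreal (?q y)) / 4"
    proof -
      have "ennreal ((?p y + ?q y) / 4) = (ennreal (?p y) + ennreal (?q y)) / 4"
        using p0[of y] q0[of y] divide_ennreal[of "?p y + ?q y" 4] by simp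
      then show ?thesis
        using p0[of y] q0[of y] by (subst ennreal_plus) auto
    qed
    finally have "\<Delta> * (ennreal (exp (- W)) * ennreal (?r y)) \<le>
        \<Delta> * (ennreal ?m + (ennreal (?p y) + ennreal (?q y)) / 4)"
      by (rule mult_left_mono) auto
    also have "\<dots> = ennreal ?m * \<Delta> + \<Delta> / 4 * (ennreal (?p y) + ennreal (?q y))"
      by (simp add: distrib_left divide_ennreal_def algebra_simps)
    also have "ennreal ?m * \<Delta> \<le> ennreal ?m * A y + ennreal ?m * B y"
      using mult_left_mono[OF le, of "ennreal ?m"] by (simp add: distrib_left)
    also have "\<dots> \<le> ennreal (?p y) * A y + ennreal (?q y) * B y"
      by (intro add_mono mult_right_mono ennreal_leI) auto
    finally show ?thesis by (simp add: add_mono)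
  qed
  have m[measurable]: "?p \<in> borel_measurable ?L" "?q \<in> borel_measurable ?L" "?r \<in> borel_measurable ?L"
    by measurable
  have "\<Delta> * ennreal (exp (- W)) = (\<integral>\<^sup>+y. \<Delta> * (ennreal (exp (- W)) * ennreal (?r y)) \<partial>?L)"
    using nn_integral_prod_normal_density[OF I \<sigma>, of "\<lambda>i. (s i + t i) / 2"]
    by (simp add: nn_integral_cmult)
  also have "\<dots> \<le> (\<integral>\<^sup>+y. ennreal (?p y) * A y + ennreal (?q y) * B y +
      \<Delta> / 4 * (ennreal (?p y) + ennreal (?q y)) \<partial>?L)"
    by (intro nn_integral_mono pw)
  also have "\<dots> = (\<integral>\<^sup>+y. ennreal (?p y) * A y \<partial>?L) + (\<integral>\<^sup>+y. ennreal (?q y) * B y \<partial>?L) + \<Delta> / 4 * 2"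
    using nn_integral_prod_normal_density[OF I \<sigma>, of s] nn_integral_prod_normal_density[OF I \<sigma>, of t]
    by (simp add: nn_integral_add nn_integral_cmult)
  also have "\<Delta> / 4 * 2 = \<Delta> * (1 / 2 :: ennreal)"
  proof -
    have "(2::ennreal) / 4 = 1 / 2"
      using divide_ennreal[of 2 4] divide_ennreal[of 1 2] by simp
    moreover have "\<Delta> / 4 * 2 = \<Delta> * (2 / 4)" by (simp add: divide_ennreal_def ac_simps)
    ultimately show ?thesis by simp
  qed
  finally have main: "\<Delta> * ennreal (exp (- W)) \<le>
     (\<integral>\<^sup>+y. ennreal (?p y) * A y \<partial>?L) + (\<integral>\<^sup>+y. ennreal (?q y) * B y \<partial>?L) + \<Delta> * (1 / 2)" .
  \<comment> \<open>Linearizing the affinity makes the bound additive in the observations, so it can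
    later be averaged over a random design term by term.\<close>
  have "1 \<le> ennreal (exp (- W)) + ennreal W"
    using exp_ge_add_one_self[of "- W"] W0
    by (simp add: ennreal_plus[symmetric] del: ennreal_plus)
  then have "\<Delta> \<le> \<Delta> * ennreal (exp (- W)) + \<Delta> * ennreal W"
    using mult_left_mono[of 1 "ennreal (exp (- W)) + ennreal W" \<Delta>] by (simp add: distrib_left)
  also have "\<dots> \<le> (\<integral>\<^sup>+y. ennreal (?p y) * A y \<partial>?L) + (\<integral>\<^sup>+y. ennreal (?q y) * B y \<partial>?L) +
      \<Delta> * (1 / 2) + \<Delta> * ennreal W"
    using main by (rule add_right_mono)
  also have "\<dots> = (\<integral>\<^sup>+y. ennreal (?p y) * A y \<partial>?L) + (\<integral>\<^sup>+y. ennreal (?q y) * B y \<partial>?L) +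
      \<Delta> * (1 / 2 + ennreal W)"
    by (simp add: distrib_left add.assoc)
  also have "ennreal W = (\<Sum>i\<in>I. ennreal ((s i - t i)\<^sup>2 / (8 * \<sigma>\<^sup>2)))"
    unfolding W_def by (subst sum_ennreal) auto
  finally show ?thesis
    by (simp only: nn_integral_gaussian_translate[OF I \<sigma> A] nn_integral_gaussian_translate[OF I \<sigma> B])
qed

section \<open>Assouad's method\<close>

text \<open>Splits the vertices of the hypercube into the edges in direction \<open>j\<close>: each
  subset omitting \<open>j\<close> is paired with the one obtained by adding it.\<close>

lemma sum_Pow_pairs:
  fixes h :: "'j set \<Rightarrow> 'b::comm_monoid_add"
  assumes "finite J" "j \<in> J"
  shows "(\<Sum>S\<in>Pow J. h S) = (\<Sum>S\<in>Pow (J - {j}). h S + h (insert j S))"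
proof -
  have "J = insert j (J - {j})" using assms by auto
  then have "Pow J = Pow (J - {j}) \<union> insert j ` Pow (J - {j})"
    by (metis Pow_insert)
  then have "(\<Sum>S\<in>Pow J. h S) = (\<Sum>S\<in>Pow (J - {j}). h S) + (\<Sum>S\<in>insert j ` Pow (J - {j}). h S)"
    using assms by (simp only:) (rule sum.union_disjoint, auto)
  also have "(\<Sum>S\<in>insert j ` Pow (J - {j}). h S) = (\<Sum>S\<in>Pow (J - {j}). h (insert j S))"
    by (subst sum.reindex) (auto simp: inj_on_def)
  finally show ?thesis by (simp add: sum.distrib)
qed

text \<open>Here \<open>R j S\<close> stands for the loss charged to coordinate \<open>j\<close> at
  vertex \<open>S\<close>. Every edge in direction \<open>j\<close> costs at least \<kappa>, and
  each direction has half as many edges as the cube has vertices, hence the factor 2.\<close>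

lemma assouad_average:
  fixes R :: "'j \<Rightarrow> 'j set \<Rightarrow> ennreal"
  assumes J: "finite J"
    and pair: "\<And>j S. j \<in> J \<Longrightarrow> S \<subseteq> J - {j} \<Longrightarrow> \<kappa> \<le> R j S + R j (insert j S)"
    and \<rho>: "\<And>S. S \<subseteq> J \<Longrightarrow> (\<Sum>j\<in>J. R j S) \<le> \<rho>"
  shows "of_nat (card J) * \<kappa> \<le> 2 * \<rho>"
proof (cases "J = {}")
  case False
  define m where "m = card J - 1"
  have m: "card J = Suc m" using J False by (simp add: m_def card_gt_0_iff Suc_diff_1)
  have "of_nat (2 ^ m) * (of_nat (card J) * \<kappa>) = (\<Sum>j\<in>J. \<Sum>S\<in>Pow (J - {j}). \<kappa>)"
    using J m by (simp add: card_Pow ac_simps)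
  also have "\<dots> \<le> (\<Sum>j\<in>J. \<Sum>S\<in>Pow (J - {j}). R j S + R j (insert j S))"
    by (intro sum_mono pair) auto
  also have "\<dots> = (\<Sum>j\<in>J. \<Sum>S\<in>Pow J. R j S)"
    using J by (intro sum.cong refl sum_Pow_pairs[symmetric])
  also have "\<dots> = (\<Sum>S\<in>Pow J. \<Sum>j\<in>J. R j S)"
    by (rule sum.swap)
  also have "\<dots> \<le> (\<Sum>S\<in>Pow J. \<rho>)"
    by (intro sum_mono \<rho>) auto
  also have "\<dots> = of_nat (2 ^ m) * (2 * \<rho>)"
    using J m by (simp add: card_Pow ac_simps)
  finally show ?thesis
    by (subst (asm) ennreal_mult_le_mult_iff) (auto simp: power_eq_top_ennreal)
qed simp

text \<open>The constant 16 has three sources: an estimator facing two functions that differ by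
  \<open>\<phi> j\<close> loses at least half the squared norm of \<open>\<phi> j\<close> in total,
  the two-point inequality keeps a quarter of that, and averaging over the vertices halves it.
  Assumption \<open>upper\<close> is calibrated to this quarter.\<close>

lemma assouad_regression:
  fixes \<nu> :: "'a measure" and \<phi> :: "'j \<Rightarrow> 'a \<Rightarrow> real" and B :: "'j \<Rightarrow> 'a set"
  assumes \<nu>: "prob_space \<nu>" and J: "finite J" and \<sigma>: "\<sigma> > 0" and n: "n \<ge> 1"
    and base[measurable]: "base \<in> borel_measurable \<nu>"
    and \<phi>[measurable]: "\<And>j. \<phi> j \<in> borel_measurable \<nu>"
    and B[measurable]: "\<And>j. B j \<in> sets \<nu>" and disj: "disjoint_family_on B J"
    and supp: "\<And>j x. j \<in> J \<Longrightarrow> x \<notin> B j \<Longrightarrow> \<phi> j x = 0"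
    and upper: "\<And>j. j \<in> J \<Longrightarrow> of_nat n * (\<integral>\<^sup>+x. ennreal ((\<phi> j x)\<^sup>2) \<partial>\<nu>) \<le> ennreal (2 * \<sigma>\<^sup>2)"
    and lower: "\<And>j. j \<in> J \<Longrightarrow> ennreal \<delta> \<le> (\<integral>\<^sup>+x. ennreal ((\<phi> j x)\<^sup>2) \<partial>\<nu>)"
    and F: "\<And>S. S \<subseteq> J \<Longrightarrow> (\<lambda>x. base x + (\<Sum>j\<in>S. \<phi> j x)) \<in> F"
  shows "of_nat (card J) * ennreal (\<delta> / 16) \<le> minimax_risk \<nu> (gaussian \<sigma>) n F"
  unfolding minimax_risk_def
proof (rule INF_greatest)
  fix g assume "g \<in> estimators \<nu> n"
  let ?I = "{..<n}"
  let ?P = "\<Pi>\<^sub>M i\<in>?I. \<nu>" and ?G = "\<Pi>\<^sub>M i\<in>?I. gaussian \<sigma>"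
  let ?D = "\<Pi>\<^sub>M i\<in>?I. \<nu> \<Otimes>\<^sub>M (borel :: real measure)"
  from \<open>g \<in> estimators \<nu> n\<close>
  have g[measurable]: "(\<lambda>(z, x). g z x) \<in> borel_measurable (?D \<Otimes>\<^sub>M \<nu>)"
    by (simp add: estimators_def)
  interpret \<nu>: prob_space \<nu> by fact
  have prob_gaussian: "prob_space (gaussian \<sigma>)"
    unfolding gaussian_def by (rule prob_space_normal_density[OF \<sigma>])
  interpret P: prob_space ?P by (intro prob_space_PiM \<nu>)
  interpret G: prob_space ?G by (intro prob_space_PiM prob_gaussian)
  have sets_G[measurable_cong]: "sets ?G = sets (Pi\<^sub>M ?I (\<lambda>_. borel))"
    by (intro sets_PiM_cong) (auto simp: gaussian_def)
  define f where "f S x = base x + (\<Sum>j\<in>S. \<phi> j x)" for S x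
  have f[measurable]: "f S \<in> borel_measurable \<nu>" for S
    unfolding f_def by measurable
  \<comment> \<open>The loss restricted to one block. As the blocks are disjoint, these local losses
    sum to at most the full loss, so every coordinate can be charged separately.\<close>
  define loc where "loc j S z = (\<integral>\<^sup>+x. ennreal ((f S x - g z x)\<^sup>2) * indicator (B j) x \<partial>\<nu>)" for j S z
  have loc[measurable]: "loc j S \<in> borel_measurable ?D" for j S
    unfolding loc_def by measurable
  \<comment> \<open>The design is integrated last, so that the Gaussian bound can be applied with
    the design points fixed.\<close>
  define R where "R j S = (\<integral>\<^sup>+X. \<integral>\<^sup>+\<epsilon>. loc j S (regression_data n (f S) X \<epsilon>) \<partial>?G \<partial>?P)" for j S
  have data[measurable]: "(\<lambda>(X, \<epsilon>). regression_data n (f S) X \<epsilon>) \<in> ?P \<Otimes>\<^sub>M ?G \<rightarrow>\<^sub>M ?D" for S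
    unfolding regression_data_def by measurable
  have space_data: "regression_data n (f S) X \<epsilon> \<in> space ?D" if "X \<in> space ?P" for S X \<epsilon>
    using that by (auto simp: regression_data_def space_PiM space_pair_measure PiE_iff)
  have sec: "g z \<in> borel_measurable \<nu>" if "z \<in> space ?D" for z
    using measurable_Pair2[OF g that] by simp
  have risk_ge: "(\<Sum>j\<in>J. R j S) \<le> risk \<nu> (gaussian \<sigma>) n (f S) g" for S
  proof -
    have "(\<Sum>j\<in>J. R j S) =
        (\<Sum>j\<in>J. \<integral>\<^sup>+(X, \<epsilon>). loc j S (regression_data n (f S) X \<epsilon>) \<partial>(?P \<Otimes>\<^sub>M ?G))"
      unfolding R_def
      by (intro sum.cong refl, subst G.nn_integral_fst[symmetric]) (simp_all add: case_prod_unfold)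
    also have "\<dots> = (\<integral>\<^sup>+(X, \<epsilon>). (\<Sum>j\<in>J. loc j S (regression_data n (f S) X \<epsilon>)) \<partial>(?P \<Otimes>\<^sub>M ?G))"
      by (subst nn_integral_sum[symmetric]) (auto simp: case_prod_unfold)
    also have "\<dots> \<le> (\<integral>\<^sup>+(X, \<epsilon>). sq_loss \<nu> (f S) (g (regression_data n (f S) X \<epsilon>)) \<partial>(?P \<Otimes>\<^sub>M ?G))"
    proof (rule nn_integral_mono, clarsimp simp: space_pair_measure)
      fix X \<epsilon> assume X: "X \<in> space ?P"
      define z where "z = regression_data n (f S) X \<epsilon>"
      have [measurable]: "g z \<in> borel_measurable \<nu>"
        unfolding z_def by (intro sec space_data X)
      have "(\<Sum>j\<in>J. loc j S z) =
          (\<integral>\<^sup>+x. (\<Sum>j\<in>J. ennreal ((f S x - g z x)\<^sup>2) * indicator (B j) x) \<partial>\<nu>)"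
        unfolding loc_def by (subst nn_integral_sum) auto
      also have "\<dots> \<le> (\<integral>\<^sup>+x. ennreal ((f S x - g z x)\<^sup>2) \<partial>\<nu>)"
      proof (rule nn_integral_mono)
        fix x
        have "(\<Sum>j\<in>J. indicator (B j) x :: ennreal) = indicator (\<Union>j\<in>J. B j) x"
          by (rule indicator_UN_disjoint[OF J disj, symmetric])
        also have "\<dots> \<le> 1" by (simp add: indicator_def)
        finally show "(\<Sum>j\<in>J. ennreal ((f S x - g z x)\<^sup>2) * indicator (B j) x) \<le> ennreal ((f S x - g z x)\<^sup>2)"
          using mult_left_mono[of _ 1 "ennreal ((f S x - g z x)\<^sup>2)"]
          by (simp add: sum_distrib_left[symmetric])
      qed
      finally show "(\<Sum>j\<in>J. loc j S (regression_data n (f S) X \<epsilon>)) \<le>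
          sq_loss \<nu> (f S) (g (regression_data n (f S) X \<epsilon>))"
        by (simp add: sq_loss_def z_def)
    qed
    finally show ?thesis by (simp add: risk_def regression_space_def)
  qed
  have pair: "ennreal (\<delta> / 8) \<le> R j S + R j (insert j S)" if j: "j \<in> J" and S: "S \<subseteq> J - {j}" for j S
  proof -
    define D where "D = (\<integral>\<^sup>+x. ennreal ((\<phi> j x)\<^sup>2) \<partial>\<nu>)"
    have fin: "finite S" using S J finite_subset by blast
    have fins: "f (insert j S) x = f S x + \<phi> j x" for x
    proof -
      have "j \<notin> S" using S by auto
      then show ?thesis by (simp add: f_def fin ac_simps)
    qed
    \<comment> \<open>Separates the design from the responses: for fixed \<open>X\<close>, the data
      under any regression function are the same measurable map applied to a shifted noise
      vector.\<close>
    define Z where "Z X y = (\<lambda>i\<in>?I. (X i, y i :: real))" for X :: "nat \<Rightarrow> 'a" and y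
    have rd: "regression_data n h X \<epsilon> = Z X (\<lambda>i\<in>?I. h (X i) + \<epsilon> i)" for h X \<epsilon>
      by (auto simp: regression_data_def Z_def)
    \<comment> \<open>With \<open>u\<close> the error against \<open>f S\<close>, the error against
      the toggled function is \<open>u + \<phi> j x\<close>; the sum of the squares is smallest when
      \<open>u\<close> is minus half of \<open>\<phi> j x\<close>. Off the block the left integrand
      vanishes.\<close>
    have sum_loc: "D / 2 \<le> loc j S z + loc j (insert j S) z" if z: "z \<in> space ?D" for z
    proof -
      have [measurable]: "g z \<in> borel_measurable \<nu>" by (rule sec[OF z])
      have "D / 2 = (\<integral>\<^sup>+x. ennreal ((\<phi> j x)\<^sup>2 / 2) \<partial>\<nu>)"
        unfolding D_def by (simp add: nn_integral_divide[symmetric] divide_ennreal[symmetric])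
      also have "\<dots> \<le> (\<integral>\<^sup>+x. ennreal ((f S x - g z x)\<^sup>2) * indicator (B j) x +
          ennreal ((f (insert j S) x - g z x)\<^sup>2) * indicator (B j) x \<partial>\<nu>)"
      proof (rule nn_integral_mono)
        fix x
        have "(\<phi> j x)\<^sup>2 / 2 \<le> u\<^sup>2 + (u + \<phi> j x)\<^sup>2" for u
        proof -
          have "u\<^sup>2 + (u + \<phi> j x)\<^sup>2 - (\<phi> j x)\<^sup>2 / 2 = 2 * (u + \<phi> j x / 2)\<^sup>2"
            by (simp add: power2_eq_square field_simps)
          then show ?thesis using zero_le_power2[of "u + \<phi> j x / 2"] by linarith
        qed
        from this[of "f S x - g z x"]
        show "ennreal ((\<phi> j x)\<^sup>2 / 2) \<le> ennreal ((f S x - g z x)\<^sup>2) * indicator (B j) x +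
          ennreal ((f (insert j S) x - g z x)\<^sup>2) * indicator (B j) x"
          using supp[OF j, of x]
          by (cases "x \<in> B j") (auto simp: fins algebra_simps ennreal_plus[symmetric] simp del: ennreal_plus intro!: ennreal_leI)
      qed
      also have "\<dots> = loc j S z + loc j (insert j S) z"
        unfolding loc_def by (subst nn_integral_add) auto
      finally show ?thesis .
    qed
    let ?R = "\<lambda>S X. \<integral>\<^sup>+\<epsilon>. loc j S (regression_data n (f S) X \<epsilon>) \<partial>?G"
    let ?W = "\<lambda>X. \<Sum>i\<in>?I. ennreal ((\<phi> j (X i))\<^sup>2 / (8 * \<sigma>\<^sup>2))"
    \<comment> \<open>The two mean vectors are the values of \<open>f S\<close> and
      \<open>f (insert j S)\<close> at the design points; they differ exactly by
      \<open>\<phi> j\<close>.\<close>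
    have cond: "D / 2 \<le> ?R S X + ?R (insert j S) X + D / 2 * (1 / 2 + ?W X)" if X: "X \<in> space ?P" for X
    proof -
      have spZ: "Z X y \<in> space ?D" for y
        using X by (auto simp: Z_def space_PiM space_pair_measure PiE_iff)
      have "Z X \<in> Pi\<^sub>M ?I (\<lambda>_. borel) \<rightarrow>\<^sub>M ?D"
        unfolding Z_def using X by (auto simp: space_PiM PiE_iff intro!: measurable_restrict)
      then have [measurable]: "(\<lambda>y. loc j T (Z X y)) \<in> borel_measurable (Pi\<^sub>M ?I (\<lambda>_. borel))" for T
        by measurable
      have "D / 2 \<le> (\<integral>\<^sup>+\<epsilon>. loc j S (Z X (\<lambda>i\<in>?I. f S (X i) + \<epsilon> i)) \<partial>?G) +
        (\<integral>\<^sup>+\<epsilon>. loc j (insert j S) (Z X (\<lambda>i\<in>?I. f (insert j S) (X i) + \<epsilon> i)) \<partial>?G) +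
        D / 2 * (1 / 2 + (\<Sum>i\<in>?I. ennreal ((f S (X i) - f (insert j S) (X i))\<^sup>2 / (8 * \<sigma>\<^sup>2))))"
        by (rule gaussian_two_point[OF _ \<sigma>]) (auto intro: sum_loc spZ)
      then show ?thesis by (simp add: rd fins)
    qed
    have meas_R[measurable]: "?R T \<in> borel_measurable ?P" for T
      by measurable
    \<comment> \<open>Each \<open>X i\<close> has law \<nu>, so the mean is
      \<open>n * D / (8 * \<sigma>^2)\<close>, which \<open>upper\<close> bounds by 1/4.\<close>
    have W: "(\<integral>\<^sup>+X. ?W X \<partial>?P) \<le> 1 / 4"
    proof -
      have "(\<integral>\<^sup>+X. ?W X \<partial>?P) = (\<Sum>i\<in>?I. \<integral>\<^sup>+X. ennreal ((\<phi> j (X i))\<^sup>2 / (8 * \<sigma>\<^sup>2)) \<partial>?P)"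
        by (subst nn_integral_sum) auto
      also have "\<dots> = (\<Sum>i\<in>?I. D / ennreal (8 * \<sigma>\<^sup>2))"
      proof (rule sum.cong[OF refl])
        fix i assume i: "i \<in> ?I"
        have "(\<integral>\<^sup>+X. ennreal ((\<phi> j (X i))\<^sup>2 / (8 * \<sigma>\<^sup>2)) \<partial>?P) =
            (\<integral>\<^sup>+x. ennreal ((\<phi> j x)\<^sup>2 / (8 * \<sigma>\<^sup>2)) \<partial>distr ?P \<nu> (\<lambda>X. X i))"
          using i by (subst nn_integral_distr) auto
        also have "distr ?P \<nu> (\<lambda>X. X i) = \<nu>"
          using i \<nu> distr_PiM_component[of ?I "\<lambda>_. \<nu>" i] by simp
        also have "(\<integral>\<^sup>+x. ennreal ((\<phi> j x)\<^sup>2 / (8 * \<sigma>\<^sup>2)) \<partial>\<nu>) = D / ennreal (8 * \<sigma>\<^sup>2)"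
          using \<sigma> unfolding D_def by (simp add: nn_integral_divide[symmetric] divide_ennreal)
        finally show "(\<integral>\<^sup>+X. ennreal ((\<phi> j (X i))\<^sup>2 / (8 * \<sigma>\<^sup>2)) \<partial>?P) = D / ennreal (8 * \<sigma>\<^sup>2)" .
      qed
      also have "\<dots> = (of_nat n * D) / ennreal (8 * \<sigma>\<^sup>2)"
        by (simp add: divide_ennreal_def ac_simps)
      also have "\<dots> \<le> ennreal (2 * \<sigma>\<^sup>2) / ennreal (8 * \<sigma>\<^sup>2)"
        unfolding D_def by (intro divide_right_mono_ennreal upper[OF j])
      also have "\<dots> = 1 / 4"
        using \<sigma> divide_ennreal[of 1 4] by (simp add: divide_ennreal)
      finally show ?thesis .
    qed
    have "D / 2 = (\<integral>\<^sup>+X. D / 2 \<partial>?P)"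
      by (simp add: P.emeasure_space_1)
    also have "\<dots> \<le> (\<integral>\<^sup>+X. ?R S X + ?R (insert j S) X + D / 2 * (1 / 2 + ?W X) \<partial>?P)"
      by (intro nn_integral_mono cond)
    also have "\<dots> = R j S + R j (insert j S) + D / 2 * (1 / 2 + (\<integral>\<^sup>+X. ?W X \<partial>?P))"
      by (simp add: nn_integral_add nn_integral_cmult P.emeasure_space_1 R_def)
    also have "\<dots> \<le> R j S + R j (insert j S) + D / 2 * (1 / 2 + 1 / 4)"
      by (intro add_mono mult_left_mono W) auto
    finally have le: "D / 2 \<le> R j S + R j (insert j S) + D / 2 * (1 / 2 + 1 / 4)" .
    \<comment> \<open>Finiteness of \<open>D\<close> follows from \<open>upper\<close> and
      \<open>n >= 1\<close>; it allows the term on the right of \<open>le\<close> to be subtracted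
      in the reals.\<close>
    have "D \<le> of_nat n * D"
      using n mult_right_mono[of 1 "of_nat n" D] by simp
    also have "\<dots> < \<infinity>" using upper[OF j] unfolding D_def[symmetric] by (simp add: le_less_trans)
    finally obtain D' where D': "D = ennreal D'" "D' \<ge> 0"
      by (cases D) auto
    have three_quarters: "(1 / 2 + 1 / 4 :: ennreal) = ennreal (3 / 4)"
      using divide_ennreal[of 1 2] divide_ennreal[of 1 4] ennreal_plus[of "1/2" "1/4"] by simp
    have half: "D / 2 = ennreal (D' / 2)" using D' divide_ennreal[of D' 2] by simp
    have D'_le: "\<delta> \<le> D'"
      using lower[OF j] D' unfolding D_def[symmetric] by (simp add: ennreal_le_iff)
    show ?thesis
    proof (cases "R j S + R j (insert j S)")
      case (real r)
      from le have "ennreal (D' / 2) \<le> ennreal (r + D' / 2 * (3 / 4))"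
        unfolding half three_quarters real using D' real
        by (simp add: ennreal_mult[symmetric] ennreal_plus[symmetric] del: ennreal_plus)
      then have "D' / 2 \<le> r + D' / 2 * (3 / 4)"
        using D' real by (subst (asm) ennreal_le_iff) auto
      then show ?thesis using D'_le by (simp add: real ennreal_leI)
    next
      case top
      show ?thesis by (simp only: top top_greatest)
    qed
  qed
  have "of_nat (card J) * ennreal (\<delta> / 8) \<le> 2 * (SUP f\<in>F. risk \<nu> (gaussian \<sigma>) n f g)"
  proof (rule assouad_average[where R = R, OF J])
    show "ennreal (\<delta> / 8) \<le> R j S + R j (insert j S)" if "j \<in> J" "S \<subseteq> J - {j}" for j S
      using that by (rule pair)
  next
    \<comment> \<open>The total \<rho> of \<open>assouad_average\<close> is the worst-case risk over
      \<open>F\<close>, which dominates the risk at each vertex.\<close>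
    fix S assume "S \<subseteq> J"
    then have "f S \<in> F" unfolding f_def[abs_def] by (rule F)
    then show "(\<Sum>j\<in>J. R j S) \<le> (SUP f\<in>F. risk \<nu> (gaussian \<sigma>) n f g)"
      by (intro order_trans[OF risk_ge] SUP_upper)
  qed
  moreover have "ennreal (\<delta> / 8) = 2 * ennreal (\<delta> / 16)"
    using ennreal_mult'[of 2 "\<delta> / 16"] by simp
  ultimately have "2 * (of_nat (card J) * ennreal (\<delta> / 16)) \<le> 2 * (SUP f\<in>F. risk \<nu> (gaussian \<sigma>) n f g)"
    by (simp add: ac_simps)
  then show "of_nat (card J) * ennreal (\<delta> / 16) \<le> (SUP f\<in>F. risk \<nu> (gaussian \<sigma>) n f g)"
    by (subst (asm) ennreal_mult_le_mult_iff) auto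
qed

section \<open>Paraboloids with raised caps\<close>

text \<open>At a convex combination \<open>z\<close>, the inequality for the minorant touching
  \<open>f\<close> at \<open>z\<close> passes to \<open>f\<close>. The minorants are convex rather
  than affine so that the paraboloid can itself serve as one.\<close>

lemma convex_on_if_supported:
  fixes f :: "'a::real_vector \<Rightarrow> real"
  assumes "convex T"
    and "\<And>z. z \<in> T \<Longrightarrow> \<exists>h. convex_on T h \<and> h z = f z \<and> (\<forall>x\<in>T. h x \<le> f x)"
  shows "convex_on T f"
proof (rule convex_onI[OF _ \<open>convex T\<close>])
  fix t x y assume t: "0 < t" "t < (1::real)" and xy: "x \<in> T" "y \<in> T"
  let ?z = "(1 - t) *\<^sub>R x + t *\<^sub>R y"
  have "?z \<in> T" using convexD_alt[OF \<open>convex T\<close> xy, of t] t by simp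
  then obtain h where h: "convex_on T h" "h ?z = f ?z" "\<And>x. x \<in> T \<Longrightarrow> h x \<le> f x"
    using assms(2) by blast
  have "f ?z \<le> (1 - t) * h x + t * h y"
    using convex_onD[OF h(1), of t x y] t xy h(2) by simp
  also have "\<dots> \<le> (1 - t) * f x + t * f y"
    using t xy by (intro add_mono mult_left_mono h(3)) auto
  finally show "f ?z \<le> (1 - t) * f x + t * f y" .
qed

lemma convex_on_norm_diff_square:
  fixes c :: "'a::real_inner"
  assumes "convex T"
  shows "convex_on T (\<lambda>x. (norm (x - c))\<^sup>2)"
proof (rule convex_onI[OF _ assms])
  fix t x y assume t: "0 < t" "t < (1::real)"
  have "(1 - t) * (norm (x - c))\<^sup>2 + t * (norm (y - c))\<^sup>2 -
      (norm ((1 - t) *\<^sub>R x + t *\<^sub>R y - c))\<^sup>2 = t * (1 - t) * (norm (x - y))\<^sup>2"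
    unfolding power2_norm_eq_inner
    by (simp add: inner_diff_left inner_diff_right inner_add_left inner_add_right inner_commute
        algebra_simps)
  also have "\<dots> \<ge> 0" using t by simp
  finally show "(norm ((1 - t) *\<^sub>R x + t *\<^sub>R y - c))\<^sup>2 \<le>
      (1 - t) * (norm (x - c))\<^sup>2 + t * (norm (y - c))\<^sup>2" by simp
qed

definition cap :: "real \<Rightarrow> 'a::real_inner \<Rightarrow> 'a \<Rightarrow> real" where
  "cap r p x = max 0 (r\<^sup>2 - (norm (x - p))\<^sup>2)"

lemma cap_nonneg: "cap r p x \<ge> 0"
  by (simp add: cap_def)

lemma cap_le: "cap r p x \<le> r\<^sup>2"
  by (simp add: cap_def)

lemma cap_eq_0: "r \<ge> 0 \<Longrightarrow> x \<notin> ball p r \<Longrightarrow> cap r p x = 0"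
  by (simp add: cap_def dist_norm norm_minus_commute power_mono)

lemma cap_eq: "x \<in> ball p r \<Longrightarrow> cap r p x = r\<^sup>2 - (norm (x - p))\<^sup>2"
  by (simp add: cap_def dist_norm norm_minus_commute power_mono less_imp_le)

lemma sum_cap_eq:
  assumes "finite S" "disjoint_family_on (\<lambda>j. ball (p j) r) S" "r \<ge> 0" "j \<in> S" "x \<in> ball (p j) r"
  shows "(\<Sum>i\<in>S. cap r (p i) x) = cap r (p j) x"
proof -
  have "cap r (p i) x = 0" if "i \<in> S - {j}" for i
  proof -
    have "ball (p i) r \<inter> ball (p j) r = {}"
      using that assms(2,4) by (auto simp only: disjoint_family_on_def)
    then show ?thesis using assms(3,5) by (intro cap_eq_0) auto
  qed
  then show ?thesis using assms by (simp add: sum.remove)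
qed

text \<open>At most one cap is active at any point, so the bound does not grow with the number of
  caps.\<close>

lemma sum_cap_le:
  assumes "finite S" "disjoint_family_on (\<lambda>j. ball (p j) r) S" "r \<ge> 0"
  shows "(\<Sum>i\<in>S. cap r (p i) x) \<le> r\<^sup>2"
proof (cases "\<exists>j\<in>S. x \<in> ball (p j) r")
  case True
  then show ?thesis using sum_cap_eq[OF assms] cap_le by metis
next
  case False
  then show ?thesis using assms by (simp add: cap_eq_0)
qed

text \<open>On \<open>ball p r\<close>, the function \<open>(norm (x - c))\<^sup>2 + cap r p x\<close> is the tangent plane of the
  paraboloid at \<open>p\<close> raised by \<open>r\<^sup>2\<close>, so adding caps amounts to taking a maximum with affine functions.\<close>

lemma convex_on_paraboloid_caps:
  fixes c :: "'a::real_inner"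
  assumes T: "convex T" and S: "finite S" and disj: "disjoint_family_on (\<lambda>j. ball (p j) r) S"
    and r: "r \<ge> 0"
  shows "convex_on T (\<lambda>x. (norm (x - c))\<^sup>2 + (\<Sum>j\<in>S. cap r (p j) x))"
proof (rule convex_on_if_supported[OF T])
  fix z assume "z \<in> T"
  show "\<exists>h. convex_on T h \<and> h z = (norm (z - c))\<^sup>2 + (\<Sum>j\<in>S. cap r (p j) z) \<and>
    (\<forall>x\<in>T. h x \<le> (norm (x - c))\<^sup>2 + (\<Sum>j\<in>S. cap r (p j) x))"
  proof (cases "\<exists>j\<in>S. z \<in> ball (p j) r")
    case True
    then obtain j where j: "j \<in> S" "z \<in> ball (p j) r" by blast
    define h where "h x = (norm (x - c))\<^sup>2 + (r\<^sup>2 - (norm (x - p j))\<^sup>2)" for x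
    \<comment> \<open>The quadratic terms of the two squared norms cancel, so \<open>h\<close> is
      affine.\<close>
    have "h ((1 - t) *\<^sub>R x + t *\<^sub>R y) = (1 - t) * h x + t * h y" for t x y
      unfolding h_def power2_norm_eq_inner
      by (simp add: inner_diff_left inner_diff_right inner_add_left inner_add_right inner_commute
          algebra_simps)
    then have "convex_on T h" by (intro convex_onI T) simp
    moreover have "h x \<le> (norm (x - c))\<^sup>2 + (\<Sum>j\<in>S. cap r (p j) x)" for x
    proof -
      have "r\<^sup>2 - (norm (x - p j))\<^sup>2 \<le> cap r (p j) x" by (simp add: cap_def)
      also have "\<dots> \<le> (\<Sum>j\<in>S. cap r (p j) x)"
        by (rule member_le_sum[OF j(1)]) (auto simp: cap_nonneg S)
      finally show ?thesis by (simp add: h_def)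
    qed
    ultimately show ?thesis
      using sum_cap_eq[OF S disj r j] cap_eq[OF j(2)] by (intro exI[of _ h]) (simp add: h_def)
  next
    case False
    \<comment> \<open>Outside all the balls the caps vanish, and the paraboloid is its own
      supporting minorant.\<close>
    then have "(\<Sum>j\<in>S. cap r (p j) z) = 0" using r by (intro sum.neutral) (auto intro!: cap_eq_0)
    then show ?thesis
      using convex_on_norm_diff_square[OF T, of c]
      by (intro exI[of _ "\<lambda>x. (norm (x - c))\<^sup>2"]) (auto intro!: sum_nonneg cap_nonneg)
  qed
qed

lemma borel_measurable_cap[measurable]:
  "cap r (p::'a::euclidean_space) \<in> borel_measurable borel"
  unfolding cap_def[abs_def] by measurable

section \<open>A grid of disjoint balls\<close>

text \<open>Distinct centres differ by at least \<open>2 * r\<close> in some coordinate, so the open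
  balls at most touch. Containment bounds the norm by the sum of the coordinates, which costs a
  factor of the dimension.\<close>

lemma grid_balls:
  fixes c :: "real ^ 'd" and r :: real and M :: nat
  assumes r: "r > 0"
  defines "p \<equiv> \<lambda>k. c + (\<chi> i. 2 * r * real (k i))"
  defines "J \<equiv> (UNIV :: 'd set) \<rightarrow>\<^sub>E {..<M}"
  shows "disjoint_family_on (\<lambda>k. ball (p k) r) J"
    and "\<And>k. k \<in> J \<Longrightarrow> ball (p k) r \<subseteq> ball c (2 * r * real CARD('d) * real M)"
proof -
  have "ball (p k) r \<inter> ball (p l) r = {}" if "k \<noteq> l" for k l
  proof -
    obtain i where i: "k i \<noteq> l i" using \<open>k \<noteq> l\<close> by auto
    have "2 * r \<le> 2 * r * \<bar>real (k i) - real (l i)\<bar>"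
      using i r by simp
    also have "\<dots> = \<bar>(p k - p l) $ i\<bar>"
      using r by (simp add: p_def abs_mult flip: right_diff_distrib)
    also have "\<dots> \<le> dist (p k) (p l)"
      unfolding dist_norm by (rule component_le_norm_cart)
    finally show ?thesis by (intro disjoint_ballI) simp
  qed
  then show "disjoint_family_on (\<lambda>k. ball (p k) r) J"
    by (auto simp: disjoint_family_on_def)
  fix k assume k: "k \<in> J"
  show "ball (p k) r \<subseteq> ball c (2 * r * real CARD('d) * real M)"
  proof
    fix x assume x: "x \<in> ball (p k) r"
    \<comment> \<open>Indices stop at \<open>M - 1\<close>; the slack
      \<open>2 * r * CARD('d)\<close> that this leaves absorbs the radius \<open>r\<close> of the
      ball around \<open>p k\<close>.\<close>
    have ki: "real (k i) \<le> real M - 1" for i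
    proof -
      have "k i < M" using k by (auto simp: J_def PiE_iff)
      then show ?thesis by linarith
    qed
    have "norm (p k - c) \<le> (\<Sum>i\<in>UNIV. \<bar>(p k - c) $ i\<bar>)" by (rule norm_le_l1_cart)
    also have "\<dots> \<le> (\<Sum>i\<in>(UNIV :: 'd set). 2 * r * (real M - 1))"
      using r ki by (intro sum_mono) (simp add: p_def abs_mult)
    also have "\<dots> = 2 * r * real CARD('d) * real M - 2 * r * real CARD('d)"
      by (simp add: algebra_simps)
    also have "\<dots> \<le> 2 * r * real CARD('d) * real M - r"
    proof -
      have "r * 1 \<le> r * (2 * real CARD('d))"
      proof (intro mult_left_mono)
        have "real CARD('d) \<ge> 1" by (simp add: Suc_leI)
        then show "1 \<le> 2 * real CARD('d)" by linarith
      qed (use r in simp)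
      then show ?thesis by simp
    qed
    finally have "dist (p k) c \<le> 2 * r * real CARD('d) * real M - r" by (simp add: dist_norm)
    then show "x \<in> ball c (2 * r * real CARD('d) * real M)"
      using x dist_triangle[of c x "p k"] by (simp add: dist_commute)
  qed
qed

section \<open>Calibration of the hypercube and the rate\<close>

theorem theorem2p4:
  fixes \<Omega> :: "(real ^ 'd) set" and \<nu> :: "(real ^ 'd) measure"
    and p :: "real ^ 'd \<Rightarrow> ennreal" and \<Gamma> \<sigma> :: real and k :: nat
  assumes "convex_body \<Omega>" and "\<Omega> \<in> simplicial_polytopes k"
    and "prob_space \<nu>"
    and "p \<in> borel_measurable (restrict_space lborel \<Omega>)"
    and "\<nu> = density (restrict_space lborel \<Omega>) p"
    and "(SUP x\<in>\<Omega>. p x) < \<infinity>" and "(INF x\<in>\<Omega>. p x) > 0"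
    and "\<Gamma> > 0" and "\<sigma> > 0"
  shows "\<exists>C::real. C > 0 \<and>
    (\<forall>n::nat. n \<ge> 1 \<longrightarrow>
      minimax_risk \<nu> (gaussian \<sigma>) n (bounded_convex_class \<Omega> \<Gamma>)
        \<ge> ennreal (C * real n powr (- 4 / (real CARD('d) + 4))))"
proof -
  let ?d = "CARD('d)"
  have \<Omega>: "convex \<Omega>" "bounded \<Omega>" "closed \<Omega>" "interior \<Omega> \<noteq> {}"
    using \<open>convex_body \<Omega>\<close> by (auto simp: convex_body_def compact_imp_bounded compact_imp_closed)
  then obtain c R where R: "R > 0" "ball c R \<subseteq> \<Omega>"
    by (metis equals0I mem_interior)
  then have c: "c \<in> \<Omega>" by auto
  obtain D where D: "\<And>x. x \<in> \<Omega> \<Longrightarrow> norm (x - c) \<le> D"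
    using \<open>bounded \<Omega>\<close> bounded_any_center[of \<Omega> c] by (auto simp: dist_norm norm_minus_commute)
  have [measurable]: "\<Omega> \<in> sets borel" using \<open>closed \<Omega>\<close> by auto
  obtain V where V: "V \<ge> 0" "(SUP x\<in>\<Omega>. p x) = ennreal V"
    using \<open>(SUP x\<in>\<Omega>. p x) < \<infinity>\<close> by (cases "SUP x\<in>\<Omega>. p x") auto
  have pV: "p x \<le> ennreal V" if "x \<in> \<Omega>" for x
    using SUP_upper[OF that, of p] V by simp
  have "(INF x\<in>\<Omega>. p x) < \<infinity>"
    using INF_lower[OF c, of p] pV[OF c] by (simp add: le_less_trans)
  then obtain v where v: "v > 0" "(INF x\<in>\<Omega>. p x) = ennreal v"
    using \<open>(INF x\<in>\<Omega>. p x) > 0\<close> by (cases "INF x\<in>\<Omega>. p x") auto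
  have pv: "ennreal v \<le> p x" if "x \<in> \<Omega>" for x
    using INF_lower[OF that, of p] v by simp
  have sets_\<nu>: "sets \<nu> = sets (restrict_space borel \<Omega>)"
    using \<open>\<nu> = _\<close> by (simp add: sets_restrict_space)
  have borel_\<nu>: "h \<in> borel_measurable \<nu>" if "h \<in> borel_measurable borel" for h :: "real ^ 'd \<Rightarrow> real"
    using measurable_restrict_space1[OF that] by (simp add: measurable_cong_sets[OF sets_\<nu> refl])
  \<comment> \<open>On Borel subsets of \<Omega>, the design law is comparable with Lebesgue
    measure, so volumes of balls bound their \<nu>-mass on both sides.\<close>
  have \<nu>_bounds: "ennreal v * emeasure lborel A \<le> emeasure \<nu> A"
      "emeasure \<nu> A \<le> ennreal V * emeasure lborel A"
    and sets_\<nu>I: "A \<in> sets \<nu>" if "A \<subseteq> \<Omega>" "A \<in> sets borel" for A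
  proof -
    show A: "A \<in> sets \<nu>"
      using that by (auto simp: sets_\<nu> sets_restrict_space_iff)
    have "emeasure \<nu> A = (\<integral>\<^sup>+x. p x * indicator A x \<partial>restrict_space lborel \<Omega>)"
      using A assms(4) unfolding \<open>\<nu> = _\<close> by (subst emeasure_density) auto
    also have "\<dots> = (\<integral>\<^sup>+x. p x * indicator A x * indicator \<Omega> x \<partial>lborel)"
      by (rule nn_integral_restrict_space) auto
    also have "\<dots> = (\<integral>\<^sup>+x. p x * indicator A x \<partial>lborel)"
      using that by (intro nn_integral_cong) (auto simp: indicator_def)
    finally have eq: "emeasure \<nu> A = (\<integral>\<^sup>+x. p x * indicator A x \<partial>lborel)" .
    have "ennreal v * emeasure lborel A = (\<integral>\<^sup>+x. ennreal v * indicator A x \<partial>lborel)"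
      using that by (simp add: nn_integral_cmult_indicator)
    also have "\<dots> \<le> emeasure \<nu> A"
      unfolding eq using that pv by (intro nn_integral_mono) (auto simp: indicator_def)
    finally show "ennreal v * emeasure lborel A \<le> emeasure \<nu> A" .
    have "emeasure \<nu> A \<le> (\<integral>\<^sup>+x. ennreal V * indicator A x \<partial>lborel)"
      unfolding eq using that pV by (intro nn_integral_mono) (auto simp: indicator_def)
    also have "\<dots> = ennreal V * emeasure lborel A"
      using that by (simp add: nn_integral_cmult_indicator)
    finally show "emeasure \<nu> A \<le> ennreal V * emeasure lborel A" .
  qed
  define w where "w = unit_ball_vol (real ?d)"
  have w: "w > 0" by (simp add: w_def)
  \<comment> \<open>With \<open>r = \<rho> / M\<close>, the radius \<open>2 * r * d * M\<close> from
    \<open>grid_balls\<close> is exactly \<open>R\<close>.\<close>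
  define \<rho> where "\<rho> = R / (2 * real ?d)"
  have \<rho>: "\<rho> > 0" "\<rho> \<le> R"
  proof -
    have "real ?d \<ge> 1" by (simp add: Suc_leI)
    then have "1 \<le> 2 * real ?d" by linarith
    then show "\<rho> > 0" "\<rho> \<le> R"
      using R by (auto simp: \<rho>_def divide_le_eq)
  qed
  define K where "K = V * w * \<rho> ^ (?d + 4)"
  have K: "K \<ge> 0" using V w \<rho> by (simp add: K_def)
  \<comment> \<open>The bound 1 gives \<open>a^2 <= a\<close>, the second keeps all functions within
    \<Gamma>, and the third makes a single toggle undetectable. The \<open>+ 1\<close> keeps the
    denominator positive, as \<open>K\<close> is only known to be nonnegative.\<close>
  define a where "a = min 1 (min (\<Gamma> / (D\<^sup>2 + R\<^sup>2)) (2 * \<sigma>\<^sup>2 / (K + 1)))"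
  have DR: "D\<^sup>2 + R\<^sup>2 > 0" using R by (simp add: add_nonneg_pos)
  have a: "a > 0" "a * (D\<^sup>2 + R\<^sup>2) \<le> \<Gamma>" "a\<^sup>2 * K \<le> 2 * \<sigma>\<^sup>2"
  proof -
    show a0: "a > 0" using \<open>\<Gamma> > 0\<close> \<open>\<sigma> > 0\<close> K DR by (simp add: a_def)
    have "a \<le> \<Gamma> / (D\<^sup>2 + R\<^sup>2)" by (simp add: a_def)
    then show "a * (D\<^sup>2 + R\<^sup>2) \<le> \<Gamma>" using DR by (simp add: pos_le_divide_eq)
    have "a \<le> 2 * \<sigma>\<^sup>2 / (K + 1)" by (simp add: a_def)
    then have "a * (K + 1) \<le> 2 * \<sigma>\<^sup>2" using K by (simp add: pos_le_divide_eq)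
    moreover have "a\<^sup>2 * K \<le> a * (K + 1)"
    proof -
      have "a \<le> 1" by (simp add: a_def)
      then have "a\<^sup>2 \<le> a" using a0 by (simp add: power2_eq_square mult_left_le)
      then show ?thesis using K a0 by (intro mult_mono) auto
    qed
    ultimately show "a\<^sup>2 * K \<le> 2 * \<sigma>\<^sup>2" by linarith
  qed
  \<comment> \<open>This is the block loss \<open>\<delta> / 16\<close> below with \<open>r\<close>
    replaced by \<rho>, that is, multiplied by \<open>M ^ (d + 4)\<close>.\<close>
  define C' where "C' = 9 / 16 * a\<^sup>2 * v * w * \<rho> ^ (?d + 4) / 2 ^ ?d / 16"
  have C': "C' > 0" using a v w \<rho> by (simp add: C'_def)
  have "ennreal (C' / 16 * real n powr (- 4 / (real ?d + 4))) \<le>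
      minimax_risk \<nu> (gaussian \<sigma>) n (bounded_convex_class \<Omega> \<Gamma>)" if n: "n \<ge> 1" for n :: nat
  proof -
    \<comment> \<open>The ideal grid size, for which \<open>n * r ^ (d + 4)\<close> is of constant
      order. Rounding up to \<open>M\<close> at most doubles it because
      \<open>x >= 1\<close>.\<close>
    define x where "x = real n powr (1 / (real ?d + 4))"
    have x1: "x \<ge> 1" using n by (simp add: x_def ge_one_powr_ge_zero)
    have xpow: "x ^ (?d + 4) = real n"
      using n x1 by (simp add: x_def powr_powr flip: powr_realpow)
    define M where "M = nat \<lceil>x\<rceil>"
    have M: "x \<le> real M" "real M \<le> 2 * x" "real M \<ge> 1"
      using x1 by (auto simp: M_def) linarith+
    define r where "r = \<rho> / real M"
    have r: "r > 0" "r \<le> R" using \<rho> M by (auto simp: r_def field_simps intro: order_trans)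
    have r_power: "r ^ (?d + 4) = (r\<^sup>2)\<^sup>2 * r ^ ?d"
      by (simp add: power_add flip: power_mult)
    define J where "J = (UNIV :: 'd set) \<rightarrow>\<^sub>E {..<M}"
    define q where "q k = c + (\<chi> i. 2 * r * real (k i))" for k :: "'d \<Rightarrow> nat"
    have J: "finite J" "card J = M ^ ?d" by (auto simp: J_def card_funcsetE intro!: finite_PiE)
    have disj: "disjoint_family_on (\<lambda>k. ball (q k) r) J"
      unfolding q_def J_def by (rule grid_balls(1)[OF r(1)])
    have "2 * r * real ?d * real M = R"
      using M by (simp add: r_def \<rho>_def)
    then have sub: "ball (q k) r \<subseteq> \<Omega>" if "k \<in> J" for k
      using grid_balls(2)[OF r(1), of k M c] that R by (auto simp: q_def J_def)
    define \<phi> where "\<phi> k x = a * cap r (q k) x" for k x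
    \<comment> \<open>On the concentric ball of radius \<open>r / 2\<close> the cap is at least
      \<open>3 / 4 * r^2\<close>; the second factor bounds the \<nu>-mass of that ball from
      below.\<close>
    define \<delta> where "\<delta> = (3 / 4 * a * r\<^sup>2)\<^sup>2 * (v * w * (r / 2) ^ ?d)"
    have "of_nat (card J) * ennreal (\<delta> / 16) \<le>
        minimax_risk \<nu> (gaussian \<sigma>) n (bounded_convex_class \<Omega> \<Gamma>)"
    \<comment> \<open>Blocks must be measurable for every index, also outside \<open>J\<close>, and
      \<nu> lives on \<Omega>; hence the intersection, which for indices in \<open>J\<close> is the
      whole ball.\<close>
    proof (rule assouad_regression[where base = "\<lambda>x. a * (norm (x - c))\<^sup>2" and \<phi> = \<phi>
          and B = "\<lambda>k. ball (q k) r \<inter> \<Omega>"])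
      show "(\<lambda>x. a * (norm (x - c))\<^sup>2) \<in> borel_measurable \<nu>" by (intro borel_\<nu>) measurable
      show "\<phi> k \<in> borel_measurable \<nu>" for k
        unfolding \<phi>_def by (intro borel_\<nu>) measurable
      show "ball (q k) r \<inter> \<Omega> \<in> sets \<nu>" for k by (intro sets_\<nu>I) auto
      show "disjoint_family_on (\<lambda>k. ball (q k) r \<inter> \<Omega>) J"
        using disj by (auto simp: disjoint_family_on_def)
      show "\<phi> k x = 0" if "k \<in> J" "x \<notin> ball (q k) r \<inter> \<Omega>" for k x
        using that sub[OF that(1)] r by (auto simp: \<phi>_def intro!: cap_eq_0)
    next
      fix k assume k: "k \<in> J"
      have "(\<integral>\<^sup>+x. ennreal ((\<phi> k x)\<^sup>2) \<partial>\<nu>) \<le>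
          (\<integral>\<^sup>+x. ennreal ((a * r\<^sup>2)\<^sup>2) * indicator (ball (q k) r) x \<partial>\<nu>)"
      proof (rule nn_integral_mono)
        fix x
        show "ennreal ((\<phi> k x)\<^sup>2) \<le> ennreal ((a * r\<^sup>2)\<^sup>2) * indicator (ball (q k) r) x"
          using a r cap_nonneg[of r "q k" x] cap_le[of r "q k" x] cap_eq_0[of r x "q k"]
          by (auto simp: \<phi>_def indicator_def intro!: ennreal_leI power_mono mult_left_mono)
      qed
      also have "\<dots> = ennreal ((a * r\<^sup>2)\<^sup>2) * emeasure \<nu> (ball (q k) r)"
        using sub[OF k] by (intro nn_integral_cmult_indicator sets_\<nu>I) auto
      also have "\<dots> \<le> ennreal ((a * r\<^sup>2)\<^sup>2) * (ennreal V * ennreal (w * r ^ ?d))"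
        using \<nu>_bounds(2)[OF sub[OF k]] r by (intro mult_left_mono) (auto simp: emeasure_ball w_def)
      finally have "of_nat n * (\<integral>\<^sup>+x. ennreal ((\<phi> k x)\<^sup>2) \<partial>\<nu>) \<le>
          of_nat n * (ennreal ((a * r\<^sup>2)\<^sup>2) * (ennreal V * ennreal (w * r ^ ?d)))"
        by (rule mult_left_mono) simp
      also have "\<dots> = ennreal (real n * ((a * r\<^sup>2)\<^sup>2 * (V * (w * r ^ ?d))))"
        using V w r by (simp add: ennreal_mult ennreal_of_nat_eq_real_of_nat)
      also have "\<dots> \<le> ennreal (2 * \<sigma>\<^sup>2)"
      proof (rule ennreal_leI)
        have "real n * ((a * r\<^sup>2)\<^sup>2 * (V * (w * r ^ ?d))) = a\<^sup>2 * (V * w * (real n * r ^ (?d + 4)))"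
          unfolding r_power power_mult_distrib by (simp only: ac_simps)
        also have "\<dots> \<le> a\<^sup>2 * (V * w * \<rho> ^ (?d + 4))"
        proof -
          \<comment> \<open>Rounding \<open>x\<close> upwards is what makes the information bound
            hold for every \<open>n\<close>.\<close>
          have "real n \<le> real M ^ (?d + 4)"
            unfolding xpow[symmetric] using M x1 by (intro power_mono) auto
          then have "real n * \<rho> ^ (?d + 4) \<le> real M ^ (?d + 4) * \<rho> ^ (?d + 4)"
            using \<rho> by (intro mult_right_mono) auto
          then have "real n * r ^ (?d + 4) \<le> \<rho> ^ (?d + 4)"
            using M by (simp add: r_def power_divide divide_le_eq ac_simps)
          then show ?thesis using V w by (intro mult_left_mono) auto
        qed
        also have "\<dots> \<le> 2 * \<sigma>\<^sup>2" using a(3) by (simp add: K_def)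
        finally show "real n * ((a * r\<^sup>2)\<^sup>2 * (V * (w * r ^ ?d))) \<le> 2 * \<sigma>\<^sup>2" .
      qed
      finally show "of_nat n * (\<integral>\<^sup>+x. ennreal ((\<phi> k x)\<^sup>2) \<partial>\<nu>) \<le> ennreal (2 * \<sigma>\<^sup>2)" .
      have half: "ball (q k) (r / 2) \<subseteq> \<Omega>" using sub[OF k] r by (auto simp: subset_iff)
      have "ennreal \<delta> = ennreal ((3 / 4 * a * r\<^sup>2)\<^sup>2) * (ennreal v * ennreal (w * (r / 2) ^ ?d))"
        using v w r by (simp add: \<delta>_def ennreal_mult mult.assoc)
      also have "\<dots> \<le> ennreal ((3 / 4 * a * r\<^sup>2)\<^sup>2) * emeasure \<nu> (ball (q k) (r / 2))"
        using \<nu>_bounds(1)[OF half] r by (intro mult_left_mono) (auto simp: emeasure_ball w_def)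
      also have "\<dots> = (\<integral>\<^sup>+x. ennreal ((3 / 4 * a * r\<^sup>2)\<^sup>2) * indicator (ball (q k) (r / 2)) x \<partial>\<nu>)"
        using half by (intro nn_integral_cmult_indicator[symmetric] sets_\<nu>I) auto
      also have "\<dots> \<le> (\<integral>\<^sup>+x. ennreal ((\<phi> k x)\<^sup>2) \<partial>\<nu>)"
      proof (rule nn_integral_mono)
        fix x
        show "ennreal ((3 / 4 * a * r\<^sup>2)\<^sup>2) * indicator (ball (q k) (r / 2)) x \<le> ennreal ((\<phi> k x)\<^sup>2)"
        proof (cases "x \<in> ball (q k) (r / 2)")
          case True
          then have "(norm (x - q k))\<^sup>2 \<le> (r / 2)\<^sup>2"
            by (intro power_mono) (auto simp: dist_norm norm_minus_commute)
          then have "3 / 4 * r\<^sup>2 \<le> cap r (q k) x"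
            by (simp add: cap_def power_divide le_max_iff_disj)
          then have "a * (3 / 4 * r\<^sup>2) \<le> \<phi> k x"
            unfolding \<phi>_def using a by (intro mult_left_mono) auto
          then show ?thesis using True a
            by (auto intro!: ennreal_leI power_mono simp: ac_simps)
        qed simp
      qed
      finally show "ennreal \<delta> \<le> (\<integral>\<^sup>+x. ennreal ((\<phi> k x)\<^sup>2) \<partial>\<nu>)" .
    next
      fix S assume S: "S \<subseteq> J"
      have fin: "finite S" using S J finite_subset by blast
      have disjS: "disjoint_family_on (\<lambda>k. ball (q k) r) S"
        using disj S by (rule disjoint_family_on_mono[rotated])
      let ?h = "\<lambda>x. (norm (x - c))\<^sup>2 + (\<Sum>k\<in>S. cap r (q k) x)"
      have eq: "(\<lambda>x. a * (norm (x - c))\<^sup>2 + (\<Sum>k\<in>S. \<phi> k x)) = (\<lambda>x. a * ?h x)"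
        by (simp add: \<phi>_def sum_distrib_left distrib_left)
      have "convex_on \<Omega> (\<lambda>x. a * ?h x)"
        using a r by (intro convex_on_cmul convex_on_paraboloid_caps \<Omega> fin disjS) auto
      moreover have "\<bar>a * ?h x\<bar> \<le> \<Gamma>" if x: "x \<in> \<Omega>" for x
      proof -
        have h0: "?h x \<ge> 0" by (intro add_nonneg_nonneg sum_nonneg cap_nonneg) auto
        \<comment> \<open>The paraboloid contributes at most \<open>D^2\<close> on \<Omega>, and the
          caps together at most \<open>r^2\<close>.\<close>
        have "?h x \<le> D\<^sup>2 + r\<^sup>2"
          using D[OF x] r by (intro add_mono sum_cap_le fin disjS power_mono) auto
        also have "\<dots> \<le> D\<^sup>2 + R\<^sup>2" using r by (simp add: power_mono)
        finally have "a * ?h x \<le> a * (D\<^sup>2 + R\<^sup>2)" using a by (intro mult_left_mono) auto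
        also have "\<dots> \<le> \<Gamma>" by (rule a(2))
        finally show ?thesis using mult_nonneg_nonneg[OF less_imp_le[OF a(1)] h0] by linarith
      qed
      ultimately show "(\<lambda>x. a * (norm (x - c))\<^sup>2 + (\<Sum>k\<in>S. \<phi> k x)) \<in> bounded_convex_class \<Omega> \<Gamma>"
        unfolding eq by (simp add: bounded_convex_class_def)
    qed (use J n \<open>\<sigma> > 0\<close> \<open>prob_space \<nu>\<close> in auto)
    moreover have "ennreal (C' / 16 * real n powr (- 4 / (real ?d + 4))) \<le> of_nat (card J) * ennreal (\<delta> / 16)"
    proof -
      \<comment> \<open>The \<open>M ^ d\<close> blocks cost \<open>C' / M ^ (d + 4)\<close> each,
        in total \<open>C' / M ^ 4\<close>; replacing \<open>M\<close> by \<open>2 * x\<close>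
        yields the rate and the factor 16.\<close>
      have "real n powr (- 4 / (real ?d + 4)) = x powr (- 4)"
        by (simp add: x_def powr_powr)
      also have "\<dots> = 1 / x ^ 4"
        using x1 by (simp add: powr_minus_divide)
      finally have "C' / 16 * real n powr (- 4 / (real ?d + 4)) = C' / (2 * x) ^ 4"
        by (simp add: power_mult_distrib)
      also have "\<dots> \<le> C' / real M ^ 4"
        using C' M x1 by (intro divide_left_mono power_mono mult_pos_pos zero_less_power) auto
      also have "\<dots> = real M ^ ?d * (C' / real M ^ (?d + 4))"
        using M by (simp add: power_add)
      also have "C' / real M ^ (?d + 4) = 9 / 16 * a\<^sup>2 * v * w * r ^ (?d + 4) / 2 ^ ?d / 16"
        by (simp add: C'_def r_def power_divide)
      also have "\<dots> = \<delta> / 16"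
        unfolding \<delta>_def r_power power_mult_distrib by (simp add: power_divide)
      finally have "ennreal (C' / 16 * real n powr (- 4 / (real ?d + 4))) \<le> ennreal (real M ^ ?d * (\<delta> / 16))"
        by (rule ennreal_leI)
      also have "\<dots> = of_nat (card J) * ennreal (\<delta> / 16)"
      proof -
        have "\<delta> / 16 \<ge> 0" using v w r by (simp add: \<delta>_def)
        then have "ennreal (real M ^ ?d * (\<delta> / 16)) = ennreal (real M ^ ?d) * ennreal (\<delta> / 16)"
          by (intro ennreal_mult) auto
        also have "ennreal (real M ^ ?d) = of_nat (card J)"
          unfolding J ennreal_of_nat_eq_real_of_nat by (simp only: of_nat_power)
        finally show ?thesis .
      qed
      finally show ?thesis .
    qed
    ultimately show ?thesis by (rule order_trans[rotated])
  qed
  then show ?thesis using C' by (intro exI[of _ "C' / 16"]) auto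
qed

end
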